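(* Let $n \geq 5$ and $p \geq 3$. In the $p$-player Zeckendorf game starting from $n$ copies of $1$, no player has a winning strategy.
   Context: Let $F_1=1$, $F_2=2$, $F_{i+1}=F_i+F_{i-1}$ (so $F_3=3$, $F_4=5,\dots$). The Zeckendorf game on $n$ starts with the unordered list (multiset) consisting of $n$ copies of $F_1=1$. A move is one of: (1) if the list contains $F_{i-1}$ and $F_i$, replace them by $F_{i+1}$; (2) if the list contains two copies of $F_i$: for $i=1$ replace them by $F_2$ ($1+1=2$); for $i=2$ replace them by $F_1,F_3$ ($2+2=1+3$); for $i\geq 3$ replace them by $F_{i-2},F_{i+1}$. The game ends when the list is the Zeckendorf decomposition of $n$ (a sum of distinct, pairwise non-consecutive Fibonacci numbers $F_i$); every game terminates. In the $p$-player game, players $1,2,\dots,p$ move in the cyclic order $1,2,\dots,p,1,2,\dots$, starting with player $1$; the player who makes the final move (creating the Zeckendorf decomposition) wins. A player has a winning strategy if he can choose his moves so that he makes the final move no matter what moves the other players make. *)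

theory Defs
  imports "HOL-Library.Multiset" "HOL-Number_Theory.Fib"
begin

text \<open>The library has \<open>fib 1 = fib 2 = 1\<close>; the shift gives \<open>1, 2, 3, 5, \<dots>\<close> for \<open>i = 1, 2, 3, 4, \<dots>\<close>.
  Only indices \<open>i \<ge> 1\<close> are used below.\<close>

definition zfib :: "nat \<Rightarrow> nat" where
  "zfib i = fib (i + 1)"

text \<open>Positions are multisets of Fibonacci numbers (the values, not their indices).\<close>

inductive zeckendorf_move :: "nat multiset \<Rightarrow> nat multiset \<Rightarrow> bool" where
  combine: "i \<ge> 2 \<Longrightarrow> zeckendorf_move (R + {#zfib (i - 1), zfib i#}) (R + {#zfib (i + 1)#})"
| split_one: "zeckendorf_move (R + {#zfib 1, zfib 1#}) (R + {#zfib 2#})"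
| split_two: "zeckendorf_move (R + {#zfib 2, zfib 2#}) (R + {#zfib 1, zfib 3#})"
| split: "i \<ge> 3 \<Longrightarrow> zeckendorf_move (R + {#zfib i, zfib i#}) (R + {#zfib (i - 2), zfib (i + 1)#})"

definition zeckendorf_decomposition :: "nat \<Rightarrow> nat multiset \<Rightarrow> bool" where
  "zeckendorf_decomposition n M \<longleftrightarrow>
     (\<exists>I. finite I \<and> (\<forall>i\<in>I. 1 \<le> i \<and> i + 1 \<notin> I) \<and>
          M = image_mset zfib (mset_set I)) \<and> sum_mset M = n"

text \<open>A history lists all positions reached so far, starting position included; so a history
  of length \<open>l\<close> contains \<open>l - 1\<close> moves.\<close>

definition game_history :: "nat \<Rightarrow> nat multiset list \<Rightarrow> bool" where
  "game_history n h \<longleftrightarrow>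
     h \<noteq> [] \<and> hd h = replicate_mset n (zfib 1) \<and>
     (\<forall>m. m + 1 < length h \<longrightarrow>
        \<not> zeckendorf_decomposition n (h ! m) \<and> zeckendorf_move (h ! m) (h ! (m + 1)))"

definition complete_play :: "nat \<Rightarrow> nat multiset list \<Rightarrow> bool" where
  "complete_play n h \<longleftrightarrow> game_history n h \<and> zeckendorf_decomposition n (last h)"

text \<open>The player, among \<open>1, \<dots>, p\<close>, making the move from \<open>h ! m\<close> to \<open>h ! (m + 1)\<close>.\<close>

definition mover :: "nat \<Rightarrow> nat \<Rightarrow> nat" where
  "mover p m = m mod p + 1"

text \<open>A strategy of player \<open>k\<close> maps the history so far to the next position; it must prescribe a
  legal move whenever it is \<open>k\<close>'s turn in an unfinished game.\<close>

definition legal_strategy ::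
  "nat \<Rightarrow> nat \<Rightarrow> nat \<Rightarrow> (nat multiset list \<Rightarrow> nat multiset) \<Rightarrow> bool" where
  "legal_strategy n p k \<sigma> \<longleftrightarrow>
     (\<forall>h. game_history n h \<and> \<not> zeckendorf_decomposition n (last h) \<and>
          mover p (length h - 1) = k \<longrightarrow> zeckendorf_move (last h) (\<sigma> h))"

definition follows_strategy ::
  "nat \<Rightarrow> nat \<Rightarrow> (nat multiset list \<Rightarrow> nat multiset) \<Rightarrow> nat multiset list \<Rightarrow> bool" where
  "follows_strategy p k \<sigma> h \<longleftrightarrow>
     (\<forall>m. m + 1 < length h \<and> mover p m = k \<longrightarrow> h ! (m + 1) = \<sigma> (take (m + 1) h))"

definition wins_play :: "nat \<Rightarrow> nat \<Rightarrow> nat multiset list \<Rightarrow> bool" where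
  "wins_play p k h \<longleftrightarrow> length h \<ge> 2 \<and> mover p (length h - 2) = k"

text \<open>Every game terminates, so it suffices to quantify over finite complete plays.\<close>

definition has_winning_strategy :: "nat \<Rightarrow> nat \<Rightarrow> nat \<Rightarrow> bool" where
  "has_winning_strategy n p k \<longleftrightarrow>
     (\<exists>\<sigma>. legal_strategy n p k \<sigma> \<and>
          (\<forall>h. complete_play n h \<and> follows_strategy p k \<sigma> h \<longrightarrow> wins_play p k h))"

end

theory Submission
  imports Defs "HOL-Number_Theory.Cong"
begin

text \<open>
  Call a position together with the number of moves made so far won for player \<open>k\<close> if \<open>k\<close> can force
  to make the final move. The winner depends on the number of moves only modulo \<open>p\<close>, so if a
  position were won for \<open>k\<close> after \<open>m\<close> and after \<open>m'\<close> moves with \<open>m\<close> and \<open>m'\<close> incongruent modulo \<open>p\<close>,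
  two different players could both force to make the final move of the same game. Hence \<open>k\<close>
  cannot have won when the next two players are opponents and they can reach one position both in
  one move and in two moves; each of the sublists \<open>1,1,2\<close>, \<open>1,2,2\<close>, \<open>1,2,3\<close> and \<open>2,3,3\<close> allows this.
  The opponents of \<open>k\<close> can steer the opening of the game into such a position or, in a few cases,
  directly into one that contradicts the uniqueness of the winner; for \<open>n = 5\<close> and \<open>k = 2, 3\<close> they
  can make the fourth move end the game.
\<close>

section \<open>Moves and termination\<close>

lemma zfib_numeral_simps [simp]:
  "zfib (Suc 0) = 1" "zfib 2 = 2" "zfib 3 = 3" "zfib 4 = 5"
  by (simp_all add: zfib_def numeral_eq_Suc)

lemma zfib_less:
  assumes "1 \<le> i" "i < j"
  shows "zfib i < zfib j"
proof -
  have "zfib i < zfib (i + 1)"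
    using assms(1) by (simp add: zfib_def fib_neq_0_nat)
  also have "\<dots> \<le> zfib j"
    using assms(2) unfolding zfib_def by (intro fib_mono) simp
  finally show ?thesis .
qed

lemma zfib_eq_iff [simp]: "1 \<le> i \<Longrightarrow> 1 \<le> j \<Longrightarrow> zfib i = zfib j \<longleftrightarrow> i = j"
  using zfib_less by (metis less_irrefl linorder_neqE_nat)

lemma zfib_add: "2 \<le> i \<Longrightarrow> zfib (i - 1) + zfib i = zfib (i + 1)"
  by (cases i) (simp_all add: zfib_def)

lemma zfib_double: "3 \<le> i \<Longrightarrow> zfib i + zfib i = zfib (i - 2) + zfib (i + 1)"
  by (auto simp: zfib_def numeral_eq_Suc dest!: le_Suc_ex)

text \<open>The plain weight \<open>i + 3\<close> would be preserved by the move \<open>2 + 2 = 1 + 3\<close>, hence the smaller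
  value at \<open>i = 1\<close>.\<close>

definition weight :: "nat \<Rightarrow> nat" where
  "weight x = (let i = inv_into {1..} zfib x in if i = 1 then 3 else i + 3)"

lemma weight_zfib: "1 \<le> i \<Longrightarrow> weight (zfib i) = (if i = 1 then 3 else i + 3)"
proof -
  assume "1 \<le> i"
  moreover have "inj_on zfib {1..}" by (auto intro!: inj_onI)
  ultimately show ?thesis by (simp add: weight_def)
qed

text \<open>Termination measure for the later induction along histories. For
  \<open>i \<ge> 4\<close>, splitting two copies of index \<open>i\<close> lowers the index sum from
  \<open>2 * i\<close> to \<open>2 * i - 1\<close>.\<close>

lemma zeckendorf_move_weight:
  "zeckendorf_move M M' \<Longrightarrow> (\<Sum>x\<in>#M'. weight x) < (\<Sum>x\<in>#M. weight x)"
  \<comment> \<open>Evaluating \<open>zfib 1\<close>, \<open>zfib 2\<close>, \<open>zfib 3\<close>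
    to numerals would hide the pattern of \<open>weight_zfib\<close>.\<close>
  by (induction rule: zeckendorf_move.induct) (auto simp: weight_zfib simp del: zfib_numeral_simps)

section \<open>Positions of the game\<close>

text \<open>A move invariant standing in for reachability from the start.\<close>

definition position :: "nat \<Rightarrow> nat multiset \<Rightarrow> bool" where
  "position n M \<longleftrightarrow> set_mset M \<subseteq> zfib ` {1..} \<and> sum_mset M = n"

lemma position_move: "zeckendorf_move M M' \<Longrightarrow> position n M \<Longrightarrow> position n M'"
proof (induction rule: zeckendorf_move.induct)
  case (combine i R)
  then show ?case using zfib_add[of i] by (auto simp: position_def)
next
  case (split_one R)
  then show ?case by (auto simp: position_def intro: rev_image_eqI[of 2])
next
  case (split_two R)
  then show ?case
    by (auto simp: position_def intro: rev_image_eqI[of 1] rev_image_eqI[of 3])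
next
  case (split i R)
  then show ?case using zfib_double[of i] by (auto simp: position_def)
qed

lemma count_image_mset_set_le: "inj_on f A \<Longrightarrow> count (image_mset f (mset_set A)) x \<le> 1"
  by (simp add: image_mset_mset_set count_mset_set')

text \<open>Every move consumes two equal or two consecutive Fibonacci numbers. Thus any legal move
  certifies that the game is not over.\<close>

lemma zeckendorf_decomposition_no_move:
  assumes "zeckendorf_decomposition n M"
  shows "\<not> zeckendorf_move M M'"
proof
  assume move: "zeckendorf_move M M'"
  obtain I where I: "finite I" "\<And>i. i \<in> I \<Longrightarrow> 1 \<le> i" "\<And>i. i \<in> I \<Longrightarrow> i + 1 \<notin> I"
    and M: "M = image_mset zfib (mset_set I)"
    using assms by (auto simp: zeckendorf_decomposition_def)
  have mem: "i \<in> I" if "zfib i \<in># M" "1 \<le> i" for i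
    using that I by (auto simp: M)
  have cnt: "count M x \<le> 1" for x
    unfolding M using I(2) by (intro count_image_mset_set_le inj_onI) simp
  from move show False
  proof cases
    case (combine i R)
    then have "zfib (i - 1) \<in># M" "zfib i \<in># M" by simp_all
    then show False using I(3)[of "i - 1"] mem[of "i - 1"] mem[of i] \<open>2 \<le> i\<close> by simp
  next
    case (split_one R)
    then show False using cnt[of 1] by simp
  next
    case (split_two R)
    then show False using cnt[of 2] by simp
  next
    case (split i R)
    then show False using cnt[of "zfib i"] by simp
  qed
qed

text \<open>Without equal or consecutive entries, \<open>M\<close> is the image of its index set
  \<open>I\<close>. This keeps the clause \<open>other_move\<close> of \<open>wins\<close> from
  holding vacuously.\<close>

lemma exists_zeckendorf_move:
  assumes "position n M" "\<not> zeckendorf_decomposition n M"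
  shows "\<exists>M'. zeckendorf_move M M'"
proof (rule ccontr)
  assume no_move: "\<nexists>M'. zeckendorf_move M M'"
  define I where "I = {i. 1 \<le> i \<and> zfib i \<in># M}"
  have inj: "inj_on zfib I" by (auto simp: I_def intro!: inj_onI)
  have img: "zfib ` I = set_mset M" using assms(1) by (auto simp: I_def position_def)
  then have fin: "finite I" using inj by (metis finite_imageD finite_set_mset)
  have split_pair: "\<exists>R. M = R + {#x, y#}" if "{#x, y#} \<subseteq># M" for x y
    using that by (metis subset_mset.diff_add)
  have distinct: "count M x = 1" if "x \<in># M" for x
  proof (rule ccontr)
    assume "count M x \<noteq> 1"
    then have "{#x, x#} \<subseteq># M" using that
      by (auto simp: insert_subset_eq_iff in_diff_count simp flip: count_greater_zero_iff)
    then obtain R where R: "M = R + {#x, x#}" using split_pair by blast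
    have "x \<in> zfib ` I" using that img by simp
    then obtain i where i: "1 \<le> i" "x = zfib i" by (auto simp: I_def)
    consider "i = 1" | "i = 2" | "3 \<le> i" using i by linarith
    then show False
      using no_move R i(2) zeckendorf_move.split_one zeckendorf_move.split_two
        zeckendorf_move.split by cases metis+
  qed
  have nonconsecutive: "i + 1 \<notin> I" if "i \<in> I" for i
  proof
    assume "i + 1 \<in> I"
    then have "{#zfib i, zfib (i + 1)#} \<subseteq># M"
      using that by (auto simp: insert_subset_eq_iff I_def in_diff_count)
    then obtain R where "M = R + {#zfib i, zfib (i + 1)#}" using split_pair by blast
    then show False
      using no_move zeckendorf_move.combine[of "i + 1" R] that by (auto simp: I_def)
  qed
  have "M = mset_set (set_mset M)"
    by (rule multiset_eqI) (metis distinct count_mset_set(1,3) finite_set_mset not_in_iff)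
  also have "\<dots> = image_mset zfib (mset_set I)"
    using inj img by (simp add: image_mset_mset_set)
  finally have "zeckendorf_decomposition n M"
    using assms(1) fin nonconsecutive unfolding zeckendorf_decomposition_def
    by (auto simp: position_def I_def)
  then show False using assms(2) by contradiction
qed

section \<open>Won positions\<close>

text \<open>Backward induction without histories: \<open>m\<close> counts the moves made, so the
  last one has number \<open>m - 1\<close>, and \<open>1 \<le> m\<close> guards the truncated
  subtraction.\<close>

inductive wins :: "nat \<Rightarrow> nat \<Rightarrow> nat \<Rightarrow> nat \<Rightarrow> nat multiset \<Rightarrow> bool" for n p k where
  final: "zeckendorf_decomposition n M \<Longrightarrow> 1 \<le> m \<Longrightarrow> mover p (m - 1) = k \<Longrightarrow> wins n p k m M"
| own_move: "\<not> zeckendorf_decomposition n M \<Longrightarrow> mover p m = k \<Longrightarrow> zeckendorf_move M M' \<Longrightarrow>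
    wins n p k (Suc m) M' \<Longrightarrow> wins n p k m M"
| other_move: "\<not> zeckendorf_decomposition n M \<Longrightarrow> mover p m \<noteq> k \<Longrightarrow>
    (\<And>M'. zeckendorf_move M M' \<Longrightarrow> wins n p k (Suc m) M') \<Longrightarrow> wins n p k m M"

lemma game_history_snoc:
  assumes "game_history n h" "\<not> zeckendorf_decomposition n (last h)" "zeckendorf_move (last h) M"
  shows "game_history n (h @ [M])"
  using assms unfolding game_history_def
  by (auto simp: nth_append last_conv_nth less_Suc_eq not_less)
     (drule sym, simp)+

lemma follows_strategy_snoc:
  assumes "h \<noteq> []" "follows_strategy p k \<sigma> h" "mover p (length h - 1) = k \<Longrightarrow> M = \<sigma> h"
  shows "follows_strategy p k \<sigma> (h @ [M])"
  unfolding follows_strategy_def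
proof (intro allI impI, elim conjE)
  fix m assume m: "m + 1 < length (h @ [M])" "mover p m = k"
  show "(h @ [M]) ! (m + 1) = \<sigma> (take (m + 1) (h @ [M]))"
  proof (cases "m + 1 < length h")
    case True
    then show ?thesis using assms(2) m(2) by (simp add: follows_strategy_def nth_append)
  next
    case False
    then have "length h = m + 1" using m(1) by simp
    then show ?thesis using assms(3) m(2) by (simp add: nth_append)
  qed
qed

lemma winning_strategy_imp_wins:
  assumes "has_winning_strategy n p k"
  shows "wins n p k 0 (replicate_mset n 1)"
proof -
  obtain \<sigma> where legal: "legal_strategy n p k \<sigma>"
    and winning: "\<And>h. complete_play n h \<Longrightarrow> follows_strategy p k \<sigma> h \<Longrightarrow> wins_play p k h"
    using assms by (auto simp: has_winning_strategy_def)
  \<comment> \<open>Generalised to all histories consistent with the strategy, so that the weight of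
    the last position can decrease.\<close>
  have "wins n p k (length h - 1) (last h)"
    if "game_history n h" "follows_strategy p k \<sigma> h" for h
    using that
  proof (induction "\<Sum>x\<in>#last h. weight x" arbitrary: h rule: less_induct)
    case less
    have ne: "h \<noteq> []" using less.prems(1) by (simp add: game_history_def)
    have step: "wins n p k (Suc (length h - 1)) M"
      if "\<not> zeckendorf_decomposition n (last h)" "zeckendorf_move (last h) M"
        "mover p (length h - 1) = k \<Longrightarrow> M = \<sigma> h" for M
      using less.hyps[of "h @ [M]"] zeckendorf_move_weight[OF that(2)] less.prems ne that
        game_history_snoc follows_strategy_snoc by simp
    show ?case
    proof (cases "zeckendorf_decomposition n (last h)")
      case True
      then have "wins_play p k h" using winning less.prems by (simp add: complete_play_def)
      then show ?thesis using True by (intro wins.final) (auto simp: wins_play_def numeral_2_eq_2)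
    next
      case False
      show ?thesis
      proof (cases "mover p (length h - 1) = k")
        case True
        then have "zeckendorf_move (last h) (\<sigma> h)"
          using legal False less.prems(1) by (simp add: legal_strategy_def)
        then show ?thesis using False True step wins.own_move by blast
      next
        case other: False
        then show ?thesis using False step wins.other_move by blast
      qed
    qed
  qed
  from this[of "[replicate_mset n 1]"] show ?thesis
    by (simp add: game_history_def follows_strategy_def)
qed

lemma winsD_other:
  assumes "wins n p k m M" "mover p m \<noteq> k" "zeckendorf_move M M'"
  shows "wins n p k (Suc m) M'"
  using assms zeckendorf_decomposition_no_move by (cases rule: wins.cases) auto

text \<open>The move to \<open>M'\<close> only certifies that the game is not over; the winning move
  may be another one.\<close>

lemma winsD_own:
  assumes "wins n p k m M" "mover p m = k" "zeckendorf_move M M'"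
  obtains M'' where "zeckendorf_move M M''" "wins n p k (Suc m) M''"
  using assms zeckendorf_decomposition_no_move by (cases rule: wins.cases) auto

lemma winsD_final:
  assumes "wins n p k m M" "zeckendorf_decomposition n M"
  shows "1 \<le> m" "mover p (m - 1) = k"
  using assms by (auto elim: wins.cases)

text \<open>The two wins are played against each other: a common line of play keeps both until the
  final position, whose last mover fixes the count modulo \<open>p\<close>.\<close>

lemma wins_unique:
  assumes "wins n p k m M" "wins n p k m' M" "position n M"
  shows "[m = m'] (mod p)"
  using assms
proof (induction arbitrary: m' rule: wins.induct)
  case (final M m)
  then have "1 \<le> m'" "mover p (m' - 1) = mover p (m - 1)"
    using winsD_final by blast+
  then have "[(m - 1) + 1 = (m' - 1) + 1] (mod p)"
    unfolding cong_add_rcancel_nat by (simp add: mover_def cong_def)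
  then show ?case using \<open>1 \<le> m\<close> \<open>1 \<le> m'\<close> by simp
next
  case (own_move M m M')
  show ?case
  proof (cases "mover p m' = k")
    case True
    then show ?thesis using own_move.hyps(2) by (simp add: mover_def cong_def)
  next
    case False
    \<comment> \<open>After \<open>m'\<close> moves an opponent is on turn and may copy the winning
      move that \<open>k\<close> has after \<open>m\<close> moves.\<close>
    then have "wins n p k (Suc m') M'"
      using winsD_other own_move.prems(1) own_move.hyps(3) by blast
    then have "[m + 1 = m' + 1] (mod p)"
      using own_move.IH position_move own_move.hyps(3) own_move.prems(2) by simp
    then show ?thesis unfolding cong_add_rcancel_nat .
  qed
next
  case (other_move M m)
  \<comment> \<open>Every move keeps the win counted from \<open>m\<close>, so any move keeping the
    one counted from \<open>m'\<close> will do.\<close>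
  obtain M' where "zeckendorf_move M M'" "wins n p k (Suc m') M'"
    using exists_zeckendorf_move[OF other_move.prems(2) other_move.hyps(1)]
      winsD_own winsD_other other_move.prems(1) by metis
  then have "[m + 1 = m' + 1] (mod p)"
    using other_move.IH position_move other_move.prems(2) by simp
  then show ?case unfolding cong_add_rcancel_nat .
qed

lemma wins_shortcut:
  assumes "position n M" "2 \<le> p" "wins n p k m M"
    and others: "mover p m \<noteq> k" "mover p (Suc m) \<noteq> k"
    and moves: "zeckendorf_move M T" "zeckendorf_move M M'" "zeckendorf_move M' T"
  shows False
proof -
  have "wins n p k (Suc m) T" "wins n p k (Suc (Suc m)) T"
    using assms winsD_other by blast+
  then have "[Suc m + 0 = Suc m + 1] (mod p)"
    using wins_unique position_move assms(1) moves(1) by (metis add_0_right Suc_eq_plus1)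
  then show False using \<open>2 \<le> p\<close> unfolding cong_add_lcancel_nat by (simp add: cong_def)
qed

section \<open>The opening of the game\<close>

lemma small_moves:
  "zeckendorf_move (add_mset 1 (add_mset 1 R)) (add_mset 2 R)"
  "zeckendorf_move (add_mset 1 (add_mset 2 R)) (add_mset 3 R)"
  "zeckendorf_move (add_mset 2 (add_mset 2 R)) (add_mset 1 (add_mset 3 R))"
  "zeckendorf_move (add_mset 2 (add_mset 3 R)) (add_mset 5 R)"
  "zeckendorf_move (add_mset 3 (add_mset 3 R)) (add_mset 1 (add_mset 5 R))"
  using split_one[of R] combine[of 2 R] split_two[of R] combine[of 3 R] split[of 3 R]
  by (simp_all add: add_mset_commute)

text \<open>Reduces the possible replies of \<open>k\<close> to a finite case analysis.\<close>

lemma small_move_cases: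
  assumes "zeckendorf_move M M'" "set_mset M \<subseteq> {1, 2, 3}"
  obtains "{#1, 1#} \<subseteq># M" "M' = M - {#1, 1#} + {#2#}"
  | "{#1, 2#} \<subseteq># M" "M' = M - {#1, 2#} + {#3#}"
  | "{#2, 2#} \<subseteq># M" "M' = M - {#2, 2#} + {#1, 3#}"
  | "{#2, 3#} \<subseteq># M" "M' = M - {#2, 3#} + {#5#}"
  | "{#3, 3#} \<subseteq># M" "M' = M - {#3, 3#} + {#1, 5#}"
proof -
  have small: "i \<le> 3" if "zfib i \<in># M" for i
  proof (rule ccontr)
    assume "\<not> i \<le> 3"
    then have "zfib 3 < zfib i" by (intro zfib_less) simp_all
    then show False using that assms(2) by fastforce
  qed
  from assms(1) show thesis
  proof cases
    case (combine i R)
    then have "i = 2 \<or> i = 3" using small[of i] by auto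
    then show thesis using that(2,4) combine by auto
  next
    case (split_one R)
    then show thesis using that(1) by simp
  next
    case (split_two R)
    then show thesis using that(3) by simp
  next
    case (split i R)
    then have "i = 3" using small[of i] by auto
    then show thesis using that(5) split by simp
  qed
qed

lemma position_small:
  "set_mset M \<subseteq> {1, 2, 3} \<Longrightarrow> sum_mset M = n \<Longrightarrow> position n M"
proof -
  have "{1, 2, 3} = zfib ` {1, 2, 3}" by simp
  also have "\<dots> \<subseteq> zfib ` {1..}" by (rule image_mono) simp
  finally show "set_mset M \<subseteq> {1, 2, 3} \<Longrightarrow> sum_mset M = n \<Longrightarrow> position n M"
    unfolding position_def by blast
qed

text \<open>Shortcut: \<open>1,1,2\<close> to \<open>1,3\<close> directly or via
  \<open>2,2\<close>.\<close>

lemma no_win_112: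
  assumes "wins n p k m (add_mset 1 (add_mset 1 (add_mset 2 R)))"
    and "position n (add_mset 1 (add_mset 1 (add_mset 2 R)))" "2 \<le> p"
    and "mover p m \<noteq> k" "mover p (Suc m) \<noteq> k"
  shows False
  using wins_shortcut[OF assms(2,3,1,4,5), of "add_mset 1 (add_mset 3 R)"]
    small_moves(1)[of "add_mset 2 R"] small_moves(2)[of "add_mset 1 R"] small_moves(3)[of R]
  by (metis add_mset_commute)

text \<open>Shortcut: \<open>1,2,2\<close> to \<open>2,3\<close> directly or via
  \<open>1,1,3\<close>.\<close>

lemma no_win_122:
  assumes "wins n p k m (add_mset 1 (add_mset 2 (add_mset 2 R)))"
    and "position n (add_mset 1 (add_mset 2 (add_mset 2 R)))" "2 \<le> p"
    and "mover p m \<noteq> k" "mover p (Suc m) \<noteq> k"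
  shows False
  using wins_shortcut[OF assms(2,3,1,4,5), of "add_mset 2 (add_mset 3 R)"]
    small_moves(2)[of "add_mset 2 R"] small_moves(3)[of "add_mset 1 R"]
    small_moves(1)[of "add_mset 3 R"]
  by (metis add_mset_commute)

text \<open>Shortcut: \<open>1,2,3\<close> to \<open>1,5\<close> directly or via
  \<open>3,3\<close>.\<close>

lemma no_win_123:
  assumes "wins n p k m (add_mset 1 (add_mset 2 (add_mset 3 R)))"
    and "position n (add_mset 1 (add_mset 2 (add_mset 3 R)))" "2 \<le> p"
    and "mover p m \<noteq> k" "mover p (Suc m) \<noteq> k"
  shows False
  using wins_shortcut[OF assms(2,3,1,4,5), of "add_mset 1 (add_mset 5 R)"]
    small_moves(2)[of "add_mset 3 R"] small_moves(4)[of "add_mset 1 R"] small_moves(5)[of R]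
  by (metis add_mset_commute)

text \<open>Shortcut: \<open>2,3,3\<close> to \<open>3,5\<close> directly or via
  \<open>1,2,5\<close>.\<close>

lemma no_win_233:
  assumes "wins n p k m (add_mset 2 (add_mset 3 (add_mset 3 R)))"
    and "position n (add_mset 2 (add_mset 3 (add_mset 3 R)))" "2 \<le> p"
    and "mover p m \<noteq> k" "mover p (Suc m) \<noteq> k"
  shows False
  using wins_shortcut[OF assms(2,3,1,4,5), of "add_mset 3 (add_mset 5 R)"]
    small_moves(4)[of "add_mset 3 R"] small_moves(5)[of "add_mset 2 R"]
    small_moves(2)[of "add_mset 5 R"]
  by (metis add_mset_commute)

abbreviation ones :: "nat \<Rightarrow> nat multiset" where
  "ones q \<equiv> replicate_mset q 1"

lemma move_from_ones:
  assumes "zeckendorf_move (ones (q + 2)) M"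
  shows "M = add_mset 2 (ones q)"
  using assms by (rule small_move_cases) (auto simp: insert_subset_eq_iff split: if_splits)

lemma move_from_2:
  assumes "zeckendorf_move (add_mset 2 (ones (q + 2))) M"
  shows "M = add_mset 2 (add_mset 2 (ones q)) \<or> M = add_mset 3 (ones (q + 1))"
  using assms by (rule small_move_cases) (auto simp: insert_subset_eq_iff split: if_splits)

lemma move_from_3:
  assumes "zeckendorf_move (add_mset 3 (ones (q + 2))) M"
  shows "M = add_mset 2 (add_mset 3 (ones q))"
  using assms by (rule small_move_cases) (auto simp: insert_subset_eq_iff split: if_splits)

text \<open>The second alternative records only the sublist that \<open>no_win_233\<close>
  needs.\<close>

lemma move_from_33:
  assumes "zeckendorf_move (add_mset 3 (add_mset 3 (ones q))) M"
  shows "M = add_mset 5 (ones (q + 1)) \<or> (\<exists>R. M = add_mset 2 (add_mset 3 (add_mset 3 R)))"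
  using assms by (rule small_move_cases) (auto simp: insert_subset_eq_iff split: if_splits dest: in_diffD)

lemma zeckendorf_decomposition_5: "zeckendorf_decomposition 5 {#5#}"
  unfolding zeckendorf_decomposition_def by (auto intro!: exI[of _ "{4}"])

lemma no_win_23:
  assumes wins: "wins (q + 5) p k 3 (add_mset 2 (add_mset 3 (ones q)))"
    and "3 \<le> p" "k = 2 \<or> k = 3"
  shows False
proof -
  \<comment> \<open>The fourth move belongs to player 1 if \<open>p = 3\<close> and to player 4
    otherwise.\<close>
  have other: "mover p 3 \<noteq> k"
    using assms(2,3) by (cases "p = 3") (auto simp: mover_def)
  show False
  proof (cases q)
    case 0
    have "wins 5 p k 4 {#5#}"
      using winsD_other[OF wins other small_moves(4)] 0 by simp
    from winsD_final(2)[OF this zeckendorf_decomposition_5] other show False by simp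
  next
    case (Suc r)
    have eq: "add_mset 2 (add_mset 3 (ones q)) = add_mset 1 (add_mset 2 (add_mset 3 (ones r)))"
      using Suc by simp
    have pos: "position (q + 5) (add_mset 2 (add_mset 3 (ones q)))"
      by (rule position_small) auto
    show False
    proof (cases "mover p 4 = k")
      case False
      then show False
        using no_win_123[OF wins[unfolded eq] pos[unfolded eq] _ other] \<open>3 \<le> p\<close> by simp
    next
      case True
      \<comment> \<open>The fifth move belongs to player 2, 1 or 5 according to whether
        \<open>p = 3\<close>, \<open>p = 4\<close> or \<open>p \<ge> 5\<close>.\<close>
      have [simp]: "p = 3" "k = 2"
      proof -
        show "p = 3"
          using True assms(2,3) by (cases "p = 3"; cases "p = 4") (auto simp: mover_def)
        then show "k = 2" using True by (simp add: mover_def)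
      qed
      \<comment> \<open>The opponent could move to \<open>?A\<close> at once or to
        \<open>3,3\<close> plus ones. From the latter, \<open>k\<close> either reaches
        \<open>?A\<close> one move later, against \<open>wins_unique\<close>, or leaves
        \<open>2,3,3\<close> to players 3 and 1.\<close>
      let ?A = "add_mset 5 (ones q)"
      have move_A: "zeckendorf_move (add_mset 2 (add_mset 3 (ones q))) ?A"
        by (rule small_moves)
      have wins_A: "wins (q + 5) p k 4 ?A"
        using winsD_other[OF wins other move_A] by simp
      have pos_A: "position (q + 5) ?A" using position_move[OF move_A pos] .
      have move_B: "zeckendorf_move (add_mset 2 (add_mset 3 (ones q)))
          (add_mset 3 (add_mset 3 (ones r)))"
        unfolding eq by (rule small_moves)
      have wins_B: "wins (q + 5) p k 4 (add_mset 3 (add_mset 3 (ones r)))"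
        using winsD_other[OF wins other move_B] by simp
      obtain M where M: "zeckendorf_move (add_mset 3 (add_mset 3 (ones r))) M"
          "wins (q + 5) p k 5 M"
        using winsD_own[OF wins_B True small_moves(5)] by (metis eval_nat_numeral(3) numeral_nat)
      have pos_M: "position (q + 5) M"
        using position_move[OF M(1)] position_move[OF move_B pos] by blast
      from move_from_33[OF M(1)] show False
      proof (elim disjE exE)
        assume "M = add_mset 5 (ones (r + 1))"
        then have "[4 = 5] (mod p)" using wins_unique[OF wins_A _ pos_A] M(2) Suc by simp
        then show False by (simp add: cong_def)
      next
        fix R assume "M = add_mset 2 (add_mset 3 (add_mset 3 R))"
        then show False
          using no_win_233[of "q + 5" p k 5 R] M(2) pos_M by (simp add: mover_def)
      qed
    qed
  qed
qed

theorem theorem1p3p1: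
  fixes n p :: nat
  assumes "n \<ge> 5" and "p \<ge> 3"
  shows "\<not> (\<exists>k\<in>{1..p}. has_winning_strategy n p k)"
proof
  assume "\<exists>k\<in>{1..p}. has_winning_strategy n p k"
  then obtain k where strategy: "has_winning_strategy n p k" by auto
  obtain q where n: "n = q + 5" using \<open>n \<ge> 5\<close> by (metis le_add_diff_inverse2)
  have mover: "mover p 0 = 1" "mover p 1 = 2" "mover p 2 = 3"
    using \<open>p \<ge> 3\<close> by (simp_all add: mover_def)
  have start: "wins n p k 0 (ones n)" using winning_strategy_imp_wins[OF strategy] .
  have move_0: "zeckendorf_move (ones n) (add_mset 2 (ones (q + 3)))"
    using small_moves(1)[of "ones (q + 3)"] by (simp add: n numeral_eq_Suc)
  \<comment> \<open>The first move is forced, so it does not matter whether \<open>k\<close> makes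
    it.\<close>
  have wins_1: "wins n p k 1 (add_mset 2 (ones (q + 3)))"
  proof (cases "k = 1")
    case True
    then obtain M where "zeckendorf_move (ones n) M" "wins n p k (Suc 0) M"
      using winsD_own[OF start _ move_0] mover(1) by metis
    then show ?thesis using move_from_ones[of "q + 3" M] by (simp add: n numeral_eq_Suc)
  next
    case False
    then show ?thesis using winsD_other[OF start _ move_0] mover(1) by simp
  qed
  show False
  proof (cases "k = 2 \<or> k = 3")
    case False
    have eq: "add_mset 2 (ones (q + 3)) = add_mset 1 (add_mset 1 (add_mset 2 (ones (q + 1))))"
      by (simp add: numeral_eq_Suc)
    \<comment> \<open>Players 2 and 3 are both opponents here and face \<open>1,1,2\<close>.\<close>
    have "position n (add_mset 2 (ones (q + 3)))" by (rule position_small) (auto simp: n)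
    then show False
      using no_win_112[of n p k 1 "ones (q + 1)"] wins_1 False mover assms(2) unfolding eq
      by (simp add: numeral_2_eq_2)
  next
    case True
    have ones_split: "ones (q + 3) = add_mset 1 (ones (q + 2))"
      by (simp add: numeral_eq_Suc)
    have move_1: "zeckendorf_move (add_mset 2 (ones (q + 3))) (add_mset 3 (ones (q + 2)))"
      unfolding ones_split using small_moves(2) by (metis add_mset_commute)
    have wins_2: "wins n p k 2 (add_mset 3 (ones (q + 2)))"
    proof (cases "k = 2")
      case True
      then obtain M where M: "zeckendorf_move (add_mset 2 (ones (q + 3))) M" "wins n p k (Suc 1) M"
        using winsD_own[OF wins_1 _ move_1] mover(2) by metis
      \<comment> \<open>Player 2 has two options; this one leaves \<open>1,2,2\<close> to two
        opponents.\<close>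
      have "M \<noteq> add_mset 2 (add_mset 2 (ones (q + 1)))"
      proof
        assume M_eq: "M = add_mset 2 (add_mset 2 (ones (q + 1)))"
        then have eq: "M = add_mset 1 (add_mset 2 (add_mset 2 (ones q)))" by simp
        have "position n M" unfolding M_eq by (rule position_small) (auto simp: n)
        moreover have "mover p 3 \<noteq> 2" using \<open>p \<ge> 3\<close> by (cases "p = 3") (auto simp: mover_def)
        ultimately show False
          using no_win_122[of n p k 2 "ones q"] M(2) True mover(3) \<open>p \<ge> 3\<close> unfolding eq
          by (simp add: numeral_eq_Suc)
      qed
      then have "M = add_mset 3 (ones (q + 2))"
        using move_from_2[of "q + 1" M] M(1) by (simp add: numeral_eq_Suc)
      then show ?thesis using M(2) by (simp add: numeral_2_eq_2)
    next
      case False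
      then show ?thesis using winsD_other[OF wins_1 _ move_1] mover(2) by (simp add: numeral_2_eq_2)
    qed
    have move_2: "zeckendorf_move (add_mset 3 (ones (q + 2))) (add_mset 2 (add_mset 3 (ones q)))"
      using small_moves(1)[of "add_mset 3 (ones q)"] by (simp add: add_mset_commute)
    \<comment> \<open>Forced again if \<open>k = 3\<close>, and otherwise a move of an
      opponent.\<close>
    have "wins n p k 3 (add_mset 2 (add_mset 3 (ones q)))"
    proof (cases "k = 3")
      case True
      then obtain M where M: "zeckendorf_move (add_mset 3 (ones (q + 2))) M" "wins n p k (Suc 2) M"
        using winsD_own[OF wins_2 _ move_2] mover(3) by metis
      then show ?thesis using move_from_3 by simp
    next
      case False
      then show ?thesis using winsD_other[OF wins_2 _ move_2] mover(3) by simp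
    qed
    then show False using no_win_23 True assms(2) n by blast
  qed
qed

end
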